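(* Let $d\ge 1$ and let $Y$ be a nonempty effective $\mathbb Z^d$-subshift. Then the conjugacy problem "$X\simeq Y$ with effective inputs $X$" is $D(\Sigma^0_1)$-hard.
   Context: For a finite alphabet $\mathcal A$ (a finite subset of $\mathbb N$), $\mathbb Z^d$ acts on $\mathcal A^{\mathbb Z^d}$ by $\sigma^u(x)(v)=x(v+u)$. A pattern is a function $p\colon S\to\mathcal A$ with $S\subset\mathbb Z^d$ finite; it appears in $x$ if $\sigma^u(x)|_S=p$ for some $u$. For a set $\mathcal F$ of patterns, $X_{\mathcal F}$ is the set of configurations in which no pattern from $\mathcal F$ appears. A subshift is a set of the form $X_{\mathcal F}$ (possibly empty); it is effective if $\mathcal F$ can be taken recursively enumerable. $X\simeq Y$ means there is a conjugacy, i.e. a continuous, shift-commuting bijection $X\to Y$. The subshift $Y$ is a fixed parameter. The problem is: given an effective $\mathbb Z^d$-subshift $X$ on an arbitrary finite alphabet, specified by the alphabet and a Turing machine enumerating a defining set of forbidden patterns, determine whether $X\simeq Y$. A set belongs to $D(\Sigma^0_1)$ when it is the difference of two $\Sigma^0_1$ sets; hardness is with respect to many-one reductions. *)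

theory Defs
  imports "HOL-Analysis.Finite_Cartesian_Product" "HOL-Analysis.Function_Topology"
    "HOL-Library.Nat_Bijection" "HOL-Library.Countable_Set"
begin

section \<open>Recursive functions\<close>

text \<open>
  Programs for partial recursive functions, with evaluation on argument lists. A program
  whose evaluation diverges, or that is applied to too few arguments, has no value.
  Primitive recursion runs on the first argument, and \<open>Mu f\<close> searches for the least value of
  the first argument of \<open>f\<close>. These programs play the role of Turing machines: the two models are
  translated into each other recursively, so that the notions below (recursively enumerable,
  \<open>\<Sigma>\<^sup>0\<^sub>1\<close>, many-one reducible, indices of recursively enumerable sets) do not depend on the choice.
\<close>

datatype recf =
    Zero
  | Succ
  | Proj nat
  | Comp recf "recf list"
  | PrimRec recf recf
  | Mu recf

inductive evaluates :: "recf \<Rightarrow> nat list \<Rightarrow> nat \<Rightarrow> bool" where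
  zero: "evaluates Zero xs 0"
| succ: "evaluates Succ (x # xs) (Suc x)"
| proj: "i < length xs \<Longrightarrow> evaluates (Proj i) xs (xs ! i)"
| comp: "list_all2 (\<lambda>g y. evaluates g xs y) gs ys \<Longrightarrow> evaluates f ys z
    \<Longrightarrow> evaluates (Comp f gs) xs z"
| prim_rec_0: "evaluates f xs y \<Longrightarrow> evaluates (PrimRec f g) (0 # xs) y"
| prim_rec_Suc: "evaluates (PrimRec f g) (n # xs) y \<Longrightarrow> evaluates g (n # y # xs) z
    \<Longrightarrow> evaluates (PrimRec f g) (Suc n # xs) z"
| mu: "evaluates f (n # xs) 0 \<Longrightarrow> (\<forall>m<n. \<exists>y>0. evaluates f (m # xs) y)
    \<Longrightarrow> evaluates (Mu f) xs n"

inductive_cases evaluates_elims: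
  "evaluates Zero xs z"
  "evaluates Succ xs z"
  "evaluates (Proj i) xs z"
  "evaluates (Comp f gs) xs z"
  "evaluates (PrimRec f g) (0 # xs) z"
  "evaluates (PrimRec f g) (Suc n # xs) z"
  "evaluates (Mu f) xs z"

lemma evaluates_deterministic:
  "evaluates P xs y \<Longrightarrow> evaluates P xs z \<Longrightarrow> y = z"
proof (induction P xs y arbitrary: z rule: evaluates.induct)
  case (comp xs gs ys f z z')
  from comp.prems obtain ys' where ys': "list_all2 (\<lambda>g y. evaluates g xs y) gs ys'"
    and z': "evaluates f ys' z'"
    by (rule evaluates_elims)
  have "ys = ys'"
  proof (rule nth_equalityI)
    show "length ys = length ys'"
      using comp.IH(1) ys' by (simp add: list_all2_conv_all_nth)
    show "ys ! i = ys' ! i" if "i < length ys" for i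
      using comp.IH(1) ys' that by (simp add: list_all2_conv_all_nth)
  qed
  then show ?case using comp.IH(2) z' by simp
next
  case (mu f n xs z)
  from mu.prems have "evaluates f (z # xs) 0 \<and> (\<forall>m<z. \<exists>y>0. evaluates f (m # xs) y)"
    by (rule evaluates_elims) (rule conjI)
  then have z: "evaluates f (z # xs) 0" "\<forall>m<z. \<exists>y>0. evaluates f (m # xs) y"
    by simp_all
  have "\<not> z < n" using mu.IH(2) z(1) by (metis less_irrefl)
  moreover have "\<not> n < z" using mu.IH(1) z(2) by (metis less_irrefl)
  ultimately show ?case by simp
next
  case (prim_rec_Suc f g n xs y z z')
  from prim_rec_Suc.prems obtain y' where "evaluates (PrimRec f g) (n # xs) y'"
    and "evaluates g (n # y' # xs) z'"
    by (rule evaluates_elims)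
  then show ?case using prim_rec_Suc.IH by simp
next
  case (zero xs)
  then show ?case by (auto elim: evaluates_elims)
next
  case (succ x xs)
  then show ?case by (auto elim: evaluates_elims)
next
  case (proj i xs)
  from proj.prems show ?case by (rule evaluates_elims) simp
next
  case (prim_rec_0 f xs y g)
  from prim_rec_0.prems show ?case by (rule evaluates_elims) (rule prim_rec_0.IH)
qed

fun recf_code :: "recf \<Rightarrow> nat" where
  "recf_code Zero = prod_encode (0, 0)"
| "recf_code Succ = prod_encode (1, 0)"
| "recf_code (Proj i) = prod_encode (2, i)"
| "recf_code (Comp f gs) =
    prod_encode (3, prod_encode (recf_code f, list_encode (map recf_code gs)))"
| "recf_code (PrimRec f g) = prod_encode (4, prod_encode (recf_code f, recf_code g))"
| "recf_code (Mu f) = prod_encode (5, recf_code f)"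

lemma recf_code_inject: "recf_code f = recf_code g \<Longrightarrow> f = g"
proof (induction f arbitrary: g)
  case (Comp f fs)
  then obtain h hs where g: "g = Comp h hs" by (cases g) auto
  with Comp.prems have f: "recf_code f = recf_code h"
    and fs: "map recf_code fs = map recf_code hs" by (auto simp: list_encode_eq)
  have "length fs = length hs" using fs by (rule map_eq_imp_length_eq)
  moreover have "fs ! i = hs ! i" if "i < length fs" for i
  proof (rule Comp.IH(2))
    show "fs ! i \<in> set fs" using that by simp
    show "recf_code (fs ! i) = recf_code (hs ! i)"
      using arg_cong[OF fs, of "\<lambda>cs. cs ! i"] that calculation by simp
  qed
  ultimately have "fs = hs" by (rule nth_equalityI)
  then show ?case using g Comp.IH(1)[OF f] by simp
next
  case Zero
  then show ?case by (cases g) auto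
next
  case Succ
  then show ?case by (cases g) auto
next
  case (Proj i)
  then show ?case by (cases g) auto
next
  case (PrimRec f1 f2)
  then show ?case by (cases g) auto
next
  case (Mu f)
  then show ?case by (cases g) auto
qed

definition recursive_fun :: "(nat \<Rightarrow> nat) \<Rightarrow> bool" where
  "recursive_fun f \<longleftrightarrow> (\<exists>P. \<forall>n. evaluates P [n] (f n))"

definition recursive_rel :: "(nat \<Rightarrow> nat \<Rightarrow> bool) \<Rightarrow> bool" where
  "recursive_rel R \<longleftrightarrow> (\<exists>P. \<forall>n m. evaluates P [n, m] (if R n m then 1 else 0))"

definition enumerated_by :: "recf \<Rightarrow> nat set" where
  "enumerated_by P = {c. \<exists>i. evaluates P [i] c}"

definition Sigma01 :: "nat set set" where
  "Sigma01 = {A. \<exists>R. recursive_rel R \<and> A = {n. \<exists>m. R n m}}"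

definition D_Sigma01 :: "nat set set" where
  "D_Sigma01 = {A - B | A B. A \<in> Sigma01 \<and> B \<in> Sigma01}"

definition many_one_reducible :: "nat set \<Rightarrow> nat set \<Rightarrow> bool" where
  "many_one_reducible A B \<longleftrightarrow> (\<exists>f. recursive_fun f \<and> (\<forall>n. n \<in> A \<longleftrightarrow> f n \<in> B))"

definition hard_for :: "nat set set \<Rightarrow> nat set \<Rightarrow> bool" where
  "hard_for \<C> B \<longleftrightarrow> (\<forall>A\<in>\<C>. many_one_reducible A B)"


section \<open>Subshifts\<close>

text \<open>
  The group \<open>\<int>\<^sup>d\<close> is the type \<open>int ^ 'd\<close> with \<open>d = CARD('d)\<close>, which is at least one. The function
  type carries the product topology, and \<open>nat\<close> the discrete one, so that sets of configurations
  over a finite alphabet have the usual topology as subspaces.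
\<close>

type_synonym 'd configuration = "int ^ 'd \<Rightarrow> nat"
type_synonym 'd pattern = "int ^ 'd \<rightharpoonup> nat"

definition shift :: "int ^ 'd \<Rightarrow> 'd::finite configuration \<Rightarrow> 'd configuration" where
  "shift u x = (\<lambda>v. x (v + u))"

definition patterns :: "nat set \<Rightarrow> 'd::finite pattern set" where
  "patterns A = {p. finite (dom p) \<and> ran p \<subseteq> A}"

definition appears :: "'d::finite pattern \<Rightarrow> 'd::finite configuration \<Rightarrow> bool" where
  "appears p x \<longleftrightarrow> (\<exists>u. (Some \<circ> shift u x) |` dom p = p)"

definition avoiding :: "nat set \<Rightarrow> 'd::finite pattern set \<Rightarrow> 'd::finite configuration set" where
  "avoiding A F = {x. range x \<subseteq> A \<and> (\<forall>p\<in>F. \<not> appears p x)}"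

definition conjugate :: "'d::finite configuration set \<Rightarrow> 'd configuration set \<Rightarrow> bool" where
  "conjugate X Y \<longleftrightarrow> (\<exists>\<phi>. continuous_on X \<phi> \<and> bij_betw \<phi> X Y \<and>
    (\<forall>u. \<forall>x\<in>X. \<phi> (shift u x) = shift u (\<phi> x)))"


section \<open>Effective subshifts and the conjugacy problem\<close>

text \<open>
  Every natural number is the code of a finite pattern: it is read as a list of pairs of a
  position and a symbol, and a position is read as a list of coordinates padded with zeros (surplus
  coordinates are dropped). The coordinates are numbered by \<open>to_nat_on UNIV\<close>, a bijection onto
  \<open>{..<CARD('d)}\<close>. Another bijection would permute coordinates, which is a recursive change of codes.
\<close>

definition decode_position :: "nat \<Rightarrow> int ^ 'd" where
  "decode_position n = (\<chi> i. let xs = list_decode n; k = to_nat_on (UNIV :: 'd set) i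
    in if k < length xs then int_decode (xs ! k) else 0)"

definition decode_pattern :: "nat \<Rightarrow> 'd::finite pattern" where
  "decode_pattern n =
    map_of (map (\<lambda>c. (decode_position (fst (prod_decode c)), snd (prod_decode c))) (list_decode n))"

lemma finite_dom_decode_pattern: "finite (dom (decode_pattern n))"
  by (simp add: decode_pattern_def finite_dom_map_of)

lemma surj_decode_position: "\<exists>n. decode_position n = (v :: int ^ 'd)"
proof -
  let ?e = "from_nat_into (UNIV :: 'd set)"
  define xs where "xs = map (\<lambda>k. int_encode (v $ ?e k)) [0..<CARD('d)]"
  have "to_nat_on (UNIV :: 'd set) i < CARD('d)" for i :: 'd
    using to_nat_on_finite[of "UNIV :: 'd set"] by (auto simp: bij_betw_def)
  then have "decode_position (list_encode xs) = v"
    by (simp add: decode_position_def xs_def vec_eq_iff uncountable_infinite countable_finite)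
  then show ?thesis by blast
qed

lemma surj_decode_pattern:
  fixes p :: "'d::finite pattern"
  assumes "finite (dom p)"
  shows "\<exists>n. decode_pattern n = p"
proof -
  obtain vs where vs: "set vs = dom p" using finite_list[OF assms] by (elim exE)
  obtain c where c: "\<And>v :: int ^ 'd. decode_position (c v) = v"
    by (metis surj_decode_position)
  have "decode_pattern (list_encode (map (\<lambda>v. prod_encode (c v, the (p v))) vs))
      = map_of (map (\<lambda>v. (v, the (p v))) vs)"
    by (simp add: decode_pattern_def c comp_def)
  also have "\<dots> = p"
    unfolding map_of_map_restrict vs by (rule ext) (simp add: restrict_map_def domIff)
  finally show ?thesis by blast
qed

definition re_patterns :: "'d::finite pattern set \<Rightarrow> bool" where
  "re_patterns F \<longleftrightarrow> (\<exists>P. F = decode_pattern ` enumerated_by P)"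

definition effective_subshift :: "'d::finite configuration set \<Rightarrow> bool" where
  "effective_subshift X \<longleftrightarrow>
    (\<exists>A F. finite A \<and> F \<subseteq> patterns A \<and> re_patterns F \<and> X = avoiding A F)"

text \<open>
  An input is an alphabet, given as a list of its symbols, together with a program. Every such
  pair is a legitimate input: enumerated patterns that use symbols outside the alphabet are
  disregarded. (Requiring that there are none would hide a co-recursively enumerable condition in
  the problem.)
\<close>

definition input_subshift :: "nat list \<Rightarrow> recf \<Rightarrow> 'd::finite configuration set" where
  "input_subshift as P =
    avoiding (set as) (decode_pattern ` enumerated_by P \<inter> patterns (set as))"

definition conjugacy_problem :: "'d::finite configuration set \<Rightarrow> nat set" where
  "conjugacy_problem Y =
    {prod_encode (list_encode as, recf_code P) | as P. conjugate (input_subshift as P) Y}"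

end

theory Submission
  imports Defs
begin

text \<open>
  Write \<open>Y\<close> as the subshift over \<open>A\<close> avoiding \<open>F\<close>, let \<open>b\<close> be a symbol outside \<open>A\<close>, and let \<open>C\<close>
  and \<open>D\<close> be \<open>\<Sigma>\<^sup>0\<^sub>1\<close>. For each \<open>n\<close> enumerate forbidden patterns over \<open>A \<union> {b}\<close> as follows. As soon as
  \<open>n \<in> C\<close> is witnessed, forbid the symbol \<open>b\<close> and all of \<open>F\<close>; as soon as \<open>n \<in> D\<close> is witnessed,
  forbid the empty pattern. For \<open>n \<in> C - D\<close> the result is \<open>Y\<close>. For \<open>n \<in> D\<close> it is empty, unlike \<open>Y\<close>.
  Otherwise it is the full shift on \<open>A \<union> {b}\<close>, which has more shift-invariant points (the constant
  configurations) than any subshift over \<open>A\<close>, so it is not conjugate to \<open>Y\<close>.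
\<close>

section \<open>Programs\<close>

lemma evaluates_Zero [simp]: "evaluates Zero xs y \<longleftrightarrow> y = 0"
  by (auto intro: evaluates.intros elim: evaluates_elims)

lemma evaluates_Succ [simp]: "evaluates Succ (x # xs) y \<longleftrightarrow> y = Suc x"
  by (auto intro: evaluates.intros elim: evaluates_elims)

lemma evaluates_Proj [simp]: "evaluates (Proj i) xs y \<longleftrightarrow> i < length xs \<and> y = xs ! i"
  by (auto intro: evaluates.intros elim: evaluates_elims)

lemma evaluates_Comp [simp]:
  "evaluates (Comp f gs) xs z \<longleftrightarrow>
    (\<exists>ys. list_all2 (\<lambda>g y. evaluates g xs y) gs ys \<and> evaluates f ys z)"
  by (auto intro: evaluates.intros elim: evaluates_elims)

text \<open>Together with the \<open>Cons\<close> rule, this lets the simplifier consume the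
  argument programs of a \<open>Comp\<close> one by one, so that evaluating a concrete program
  reduces to an equation for its value.\<close>

lemma ex_list_all2_Nil [simp]: "(\<exists>ys. list_all2 P [] ys \<and> R ys) \<longleftrightarrow> R []"
  by simp

lemma ex_list_all2_Cons [simp]:
  "(\<exists>ys. list_all2 P (g # gs) ys \<and> R ys) \<longleftrightarrow>
    (\<exists>y. P g y \<and> (\<exists>ys. list_all2 P gs ys \<and> R (y # ys)))"
  by (auto simp: list_all2_Cons1)

lemma evaluates_PrimRec_0 [simp]: "evaluates (PrimRec f g) (0 # xs) y \<longleftrightarrow> evaluates f xs y"
  by (auto intro: evaluates.intros elim: evaluates_elims)

lemma evaluates_PrimRec_Suc [simp]:
  "evaluates (PrimRec f g) (Suc n # xs) z \<longleftrightarrow>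
    (\<exists>y. evaluates (PrimRec f g) (n # xs) y \<and> evaluates g (n # y # xs) z)"
  by (auto intro: evaluates.intros elim: evaluates_elims)

lemma evaluates_Mu:
  "evaluates (Mu f) xs n \<longleftrightarrow>
    evaluates f (n # xs) 0 \<and> (\<forall>m<n. \<exists>y>0. evaluates f (m # xs) y)"
  by (auto intro: evaluates.intros elim: evaluates_elims)

primrec const_prog :: "nat \<Rightarrow> recf" where
  "const_prog 0 = Zero"
| "const_prog (Suc n) = Comp Succ [const_prog n]"

lemma evaluates_const_prog [simp]: "evaluates (const_prog n) xs y \<longleftrightarrow> y = n"
  by (induction n arbitrary: y) auto

definition pred_prog :: recf where
  "pred_prog = PrimRec Zero (Proj 0)"

lemma evaluates_pred_prog [simp]: "evaluates pred_prog [n] y \<longleftrightarrow> y = n - 1"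
  unfolding pred_prog_def by (induction n arbitrary: y) auto

definition is_zero_prog :: recf where
  "is_zero_prog = PrimRec (const_prog 1) Zero"

lemma evaluates_is_zero_prog [simp]:
  "evaluates is_zero_prog [n] y \<longleftrightarrow> y = (if n = 0 then 1 else 0)"
  unfolding is_zero_prog_def by (induction n arbitrary: y) (auto simp del: const_prog.simps)

definition add_prog :: recf where
  "add_prog = PrimRec (Proj 0) (Comp Succ [Proj 1])"

lemma evaluates_add_prog [simp]: "evaluates add_prog [a, b] y \<longleftrightarrow> y = a + b"
  unfolding add_prog_def by (induction a arbitrary: y) auto

definition triangle_prog :: recf where
  "triangle_prog = PrimRec Zero (Comp add_prog [Comp Succ [Proj 0], Proj 1])"

lemma evaluates_triangle_prog [simp]: "evaluates triangle_prog [n] y \<longleftrightarrow> y = triangle n"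
  unfolding triangle_prog_def by (induction n arbitrary: y) auto

definition prod_encode_prog :: recf where
  "prod_encode_prog = Comp add_prog [Comp triangle_prog [add_prog], Proj 0]"

lemma evaluates_prod_encode_prog [simp]:
  "evaluates prod_encode_prog [a, b] y \<longleftrightarrow> y = prod_encode (a, b)"
  by (auto simp: prod_encode_prog_def prod_encode_def)

text \<open>
  Primitive recursion is strict in the value at the predecessor, so branching on the argument
  itself would make the second branch diverge together with the first. Branching on a bit, with a
  total first branch, is safe.
\<close>

definition case_prog :: "recf \<Rightarrow> recf \<Rightarrow> recf" where
  "case_prog P Q =
    Comp (PrimRec (Proj 0) (Comp Q [Comp pred_prog [Proj 3], Proj 4]))
      [Comp is_zero_prog [Comp is_zero_prog [Proj 0]],
       Comp (PrimRec Zero (Comp P [Proj 2])) [Comp is_zero_prog [Proj 0], Proj 1],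
       Proj 0, Proj 1]"

lemma evaluates_case_prog_0 [simp]:
  "evaluates (case_prog P Q) [0, n] y \<longleftrightarrow> evaluates P [n] y"
  by (auto simp: case_prog_def)

text \<open>Here the inner recursion runs on the bit 0 and returns the default 0 without evaluating
  \<open>P\<close>, so a divergent \<open>P\<close> cannot block \<open>Q\<close>.\<close>

lemma evaluates_case_prog_Suc [simp]:
  "evaluates (case_prog P Q) [Suc k, n] y \<longleftrightarrow> evaluates Q [k, n] y"
  by (auto simp: case_prog_def)

lemma Sigma01_semidecision_prog:
  assumes "A \<in> Sigma01"
  obtains P where "\<And>n y. evaluates P [n] y \<longleftrightarrow> n \<in> A \<and> y = 0"
proof -
  obtain R Q where A: "A = {n. \<exists>m. R n m}"
    and Q: "\<And>n m. evaluates Q [n, m] (if R n m then 1 else 0)"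
    using assms by (auto simp: Sigma01_def recursive_rel_def)
  have Q': "evaluates Q [n, m] y \<longleftrightarrow> y = (if R n m then 1 else 0)" for n m y
    using evaluates_deterministic[OF Q] Q by blast
  let ?S = "Mu (Comp is_zero_prog [Comp Q [Proj 1, Proj 0]])"
  have "evaluates ?S [n] m \<longleftrightarrow> R n m \<and> (\<forall>l<m. \<not> R n l)" for n m
    by (auto simp: evaluates_Mu Q')
  then have "(\<exists>m. evaluates ?S [n] m) \<longleftrightarrow> n \<in> A" for n
    unfolding A using exists_least_iff[of "R n"] by simp
  \<comment> \<open>\<open>Zero\<close> discards the witness found, but composition is strict: there
    is a value only if the search halts.\<close>
  then have "evaluates (Comp Zero [?S]) [n] y \<longleftrightarrow> n \<in> A \<and> y = 0" for n y
    by (auto simp: list_all2_Cons1)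
  then show ?thesis by (rule that)
qed


section \<open>Recursive functions on codes\<close>

lemma recursive_fun_const: "recursive_fun (\<lambda>n. c)"
  unfolding recursive_fun_def by (intro exI[of _ "const_prog c"]) simp

lemma recursive_fun_Suc: "recursive_fun f \<Longrightarrow> recursive_fun (\<lambda>n. Suc (f n))"
  unfolding recursive_fun_def
proof (elim exE)
  fix P assume "\<forall>n. evaluates P [n] (f n)"
  then show "\<exists>P. \<forall>n. evaluates P [n] (Suc (f n))"
    by (intro exI[of _ "Comp Succ [P]"]) auto
qed

lemma recursive_fun_prod_encode:
  assumes "recursive_fun f" and "recursive_fun g"
  shows "recursive_fun (\<lambda>n. prod_encode (f n, g n))"
proof -
  obtain P Q where "\<And>n. evaluates P [n] (f n)" "\<And>n. evaluates Q [n] (g n)"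
    using assms by (auto simp: recursive_fun_def)
  then have "evaluates (Comp prod_encode_prog [P, Q]) [n] (prod_encode (f n, g n))" for n
    by force
  then show ?thesis by (auto simp: recursive_fun_def simp del: evaluates_Comp)
qed

lemma recursive_fun_iterate:
  assumes "recursive_fun g" and "\<And>n. f (Suc n) = g (f n)"
  shows "recursive_fun f"
proof -
  obtain Q where Q: "\<And>n. evaluates Q [n] (g n)"
    using assms(1) by (auto simp: recursive_fun_def)
  have "evaluates (PrimRec (const_prog (f 0)) (Comp Q [Proj 1])) [n] (f n)" for n
    using Q by (induction n) (force simp: assms(2))+
  then show ?thesis by (auto simp: recursive_fun_def)
qed

lemma recursive_fun_id: "recursive_fun (\<lambda>n. n)"
  unfolding recursive_fun_def by (intro exI[of _ "Proj 0"]) simp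

lemmas recursive_fun_intros =
  recursive_fun_const recursive_fun_id recursive_fun_Suc recursive_fun_prod_encode

lemma recursive_fun_const_prog: "recursive_fun (\<lambda>n. recf_code (const_prog n))"
proof (rule recursive_fun_iterate)
  \<comment> \<open>This map takes the code of \<open>p\<close> to the code of
    \<open>Comp Succ [p]\<close>; \<open>Suc (prod_encode (c, 0))\<close> is
    \<open>list_encode [c]\<close>.\<close>
  show "recursive_fun
      (\<lambda>c. prod_encode (3, prod_encode (recf_code Succ, Suc (prod_encode (c, 0)))))"
    by (intro recursive_fun_intros)
qed simp

text \<open>An instance of the s-m-n theorem: the parameter \<open>n\<close> is hardwired as the
  second argument of \<open>P\<close>.\<close>

lemma recursive_fun_smn:
  "recursive_fun (\<lambda>n. recf_code (Comp P [Proj 0, const_prog n]))"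
  by (simp only: recf_code.simps list.map list_encode.simps)
    (intro recursive_fun_intros recursive_fun_const_prog)


section \<open>Subshifts\<close>

lemma conjugate_refl: "conjugate X X"
  unfolding conjugate_def by (intro exI[of _ id]) auto

lemma conjugate_empty_iff: "conjugate {} Y \<longleftrightarrow> Y = {}"
  by (auto simp: conjugate_def bij_betw_def)

lemma shift_invariant_imp_const:
  assumes "\<And>u. shift u x = x"
  shows "x = (\<lambda>v. x 0)"
  using fun_cong[OF assms, of _ 0] by (simp add: shift_def fun_eq_iff)

text \<open>A shift-commuting injection maps fixed points of the action to fixed points. These are
  the constant configurations, so a conjugacy would inject \<open>B\<close> into
  \<open>A\<close>.\<close>

lemma full_shift_not_conjugate:
  fixes Y :: "'d::finite configuration set"
  assumes "finite A" and "card A < card B" and "Y \<subseteq> {y. range y \<subseteq> A}"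
  shows "\<not> conjugate (avoiding B {}) Y"
proof
  let ?c = "\<lambda>b (v :: int ^ 'd). b"
  assume "conjugate (avoiding B {}) Y"
  then obtain \<phi> where bij: "bij_betw \<phi> (avoiding B {}) Y"
    and eqv: "\<And>u x. x \<in> avoiding B {} \<Longrightarrow> \<phi> (shift u x) = shift u (\<phi> x)"
    by (auto simp: conjugate_def)
  have c: "?c b \<in> avoiding B {}" if "b \<in> B" for b
    using that by (auto simp: avoiding_def)
  have img: "\<phi> (?c b) = ?c (\<phi> (?c b) 0)" if "b \<in> B" for b
  proof (rule shift_invariant_imp_const)
    show "shift u (\<phi> (?c b)) = \<phi> (?c b)" for u
      using eqv[OF c[OF that], of u] by (simp add: shift_def)
  qed
  have "inj_on (\<lambda>b. \<phi> (?c b) 0) B"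
  proof (rule inj_onI)
    fix a b assume ab: "a \<in> B" "b \<in> B" "\<phi> (?c a) 0 = \<phi> (?c b) 0"
    then have "\<phi> (?c a) = \<phi> (?c b)" using img by metis
    then have "?c a = ?c b"
      by (rule inj_onD[OF bij_betw_imp_inj_on[OF bij]]) (use c ab in auto)
    then show "a = b" by meson
  qed
  moreover have "(\<lambda>b. \<phi> (?c b) 0) ` B \<subseteq> A"
    using bij_betwE[OF bij] c assms(3) by blast
  ultimately have "card B \<le> card A" by (rule card_inj_on_le[OF _ _ assms(1)])
  then show False using assms(2) by simp
qed

lemma avoiding_empty_pattern: "Map.empty \<in> F \<Longrightarrow> avoiding A F = {}"
  by (auto simp: avoiding_def appears_def intro!: bexI[of _ Map.empty])

lemma appears_singleton: "appears [0 \<mapsto> b] x \<longleftrightarrow> b \<in> range x"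
  by (auto simp: appears_def shift_def fun_eq_iff restrict_map_def)

text \<open>Patterns are matched at every translate, so the one-cell pattern at the origin bans
  \<open>b\<close> everywhere.\<close>

lemma avoiding_insert_symbol:
  assumes "b \<notin> A"
  shows "avoiding (insert b A) (insert [0 \<mapsto> b] F) = avoiding A F"
  using assms by (auto simp: avoiding_def appears_singleton)

lemma patterns_mono: "A \<subseteq> B \<Longrightarrow> patterns A \<subseteq> patterns B"
  by (auto simp: patterns_def)

text \<open>All the codings involved are injective, so a code determines its input.\<close>

lemma conjugacy_problem_iff:
  "prod_encode (list_encode as, recf_code P) \<in> conjugacy_problem Y \<longleftrightarrow>
    conjugate (input_subshift as P) Y"
  by (auto simp: conjugacy_problem_def list_encode_eq dest: recf_code_inject)

theorem proposition8p2:
  fixes Y :: "(int ^ 'd::finite \<Rightarrow> nat) set"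
  assumes "effective_subshift Y" and "Y \<noteq> {}"
  shows "hard_for D_Sigma01 (conjugacy_problem Y)"
proof -
  obtain A F where A: "finite A" "F \<subseteq> patterns A" and "re_patterns F" and Y: "Y = avoiding A F"
    using assms(1) by (auto simp: effective_subshift_def)
  then obtain Q where Q: "F = decode_pattern ` enumerated_by Q"
    by (auto simp: re_patterns_def)
  obtain b where b: "b \<notin> A" using A(1) by (metis ex_new_if_finite infinite_UNIV_nat)
  obtain as where as: "set as = insert b A" using A(1) finite_list by (metis finite.insertI)
  obtain s where s: "decode_pattern s = ([0 \<mapsto> b] :: 'd pattern)"
    using surj_decode_pattern[of "[0 \<mapsto> b]"] by auto
  have "many_one_reducible (C - D) (conjugacy_problem Y)"
    if C: "C \<in> Sigma01" and D: "D \<in> Sigma01" for C D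
  proof -
    obtain PC where PC: "\<And>n y. evaluates PC [n] y \<longleftrightarrow> n \<in> C \<and> y = 0"
      using Sigma01_semidecision_prog[OF C] by blast
    obtain PD where PD: "\<And>n y. evaluates PD [n] y \<longleftrightarrow> n \<in> D \<and> y = 0"
      using Sigma01_semidecision_prog[OF D] by blast
    \<comment> \<open>Output 0 of \<open>Q'\<close> is the code of the pattern banning
      \<open>b\<close>; the outputs of \<open>Q\<close> follow, moved up by one index.\<close>
    define Q' where "Q' = case_prog (const_prog s) (Comp Q [Proj 0])"
    \<comment> \<open>Index 0 yields 0, the code of the empty pattern, exactly when \<open>n\<close>
      is in \<open>D\<close>. At later indices \<open>Proj 1\<close> returns the output of
      \<open>Q'\<close>, but \<open>PC\<close> must halt first, which requires \<open>n\<close> to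
      be in \<open>C\<close>.\<close>
    define T where "T = case_prog PD (Comp (Proj 1) [Comp PC [Proj 1], Q'])"
    define P where "P n = Comp T [Proj 0, const_prog n]" for n
    have P: "evaluates (P n) [i] c \<longleftrightarrow> evaluates T [i, n] c" for n i c
      by (auto simp: P_def)
    have Q'_0: "evaluates Q' [0, n] c \<longleftrightarrow> c = s"
      and Q'_Suc: "evaluates Q' [Suc i, n] c \<longleftrightarrow> evaluates Q [i] c" for i n c
      by (auto simp: Q'_def)
    have T_0: "evaluates T [0, n] c \<longleftrightarrow> n \<in> D \<and> c = 0"
      and T_Suc: "evaluates T [Suc i, n] c \<longleftrightarrow> n \<in> C \<and> evaluates Q' [i, n] c" for i n c
      by (auto simp: T_def PC PD)
    have ex_nat: "(\<exists>i. R i) \<longleftrightarrow> R 0 \<or> (\<exists>i. R (Suc i))" for R :: "nat \<Rightarrow> bool"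
      by (metis not0_implies_Suc)
    have enum: "enumerated_by (P n) =
        (if n \<in> D then {0} else {}) \<union> (if n \<in> C then insert s (enumerated_by Q) else {})" for n
    proof -
      have "c \<in> enumerated_by (P n) \<longleftrightarrow>
          n \<in> D \<and> c = 0 \<or> n \<in> C \<and> (c = s \<or> c \<in> enumerated_by Q)" for c
        using ex_nat[of "\<lambda>i. evaluates T [i, n] c"] ex_nat[of "\<lambda>i. evaluates Q' [i, n] c"]
        by (auto simp: enumerated_by_def P T_0 T_Suc Q'_0 Q'_Suc)
      then show ?thesis by auto
    qed
    have conj: "conjugate (input_subshift as (P n)) Y \<longleftrightarrow> n \<in> C - D" for n
    proof -
      consider "n \<in> D" | "n \<notin> D" "n \<in> C" | "n \<notin> D" "n \<notin> C" by blast
      then show ?thesis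
      proof cases
        case 1
        have "decode_pattern 0 = (Map.empty :: 'd pattern)"
          by (simp add: decode_pattern_def)
        moreover have "0 \<in> enumerated_by (P n)" using 1 by (simp add: enum)
        ultimately have "(Map.empty :: 'd pattern) \<in> decode_pattern ` enumerated_by (P n)"
          by (metis imageI)
        moreover have "(Map.empty :: 'd pattern) \<in> patterns (set as)"
          by (simp add: patterns_def)
        ultimately have "(input_subshift as (P n) :: 'd configuration set) = {}"
          unfolding input_subshift_def by (intro avoiding_empty_pattern IntI)
        then show ?thesis using assms(2) 1 by (simp add: conjugate_empty_iff)
      next
        case 2
        \<comment> \<open>All enumerated patterns use only input symbols, so
          \<open>input_subshift\<close> disregards none of them.\<close>
        have "insert [0 \<mapsto> b] F \<subseteq> patterns (set as)"
          using A(2) patterns_mono[of A "set as"] as by (auto simp: patterns_def)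
        moreover have "decode_pattern ` enumerated_by (P n) = insert [0 \<mapsto> b] F"
          using 2 by (simp add: enum s Q)
        ultimately have "input_subshift as (P n) = Y"
          by (simp only: input_subshift_def Int_absorb2 as avoiding_insert_symbol[OF b] Y)
        then show ?thesis using 2 by (simp add: conjugate_refl)
      next
        case 3
        then have "(input_subshift as (P n) :: 'd configuration set) = avoiding (insert b A) {}"
          by (simp add: input_subshift_def enum as)
        moreover have "\<not> conjugate (avoiding (insert b A) {}) Y"
          by (rule full_shift_not_conjugate[OF A(1)]) (use A(1) b Y in \<open>auto simp: avoiding_def\<close>)
        ultimately show ?thesis using 3 by simp
      qed
    qed
    show ?thesis unfolding many_one_reducible_def
    proof (intro exI conjI allI)
      show "recursive_fun (\<lambda>n. prod_encode (list_encode as, recf_code (P n)))"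
        unfolding P_def by (intro recursive_fun_intros recursive_fun_smn)
      show "n \<in> C - D \<longleftrightarrow> prod_encode (list_encode as, recf_code (P n)) \<in> conjugacy_problem Y" for n
        by (simp add: conjugacy_problem_iff conj)
    qed
  qed
  then show ?thesis by (auto simp: hard_for_def D_Sigma01_def)
qed

end
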